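(* Let $\mathcal{DB}_i=(\mathcal{D}_i,\mathcal{IC}_i)$, $i=1,\dots,n$, be consistent databases, let $\mathcal{D}=\bigcup_{i=1}^n\mathcal{D}_i$ and $\mathcal{IC}=\bigcup_{i=1}^n\mathcal{IC}_i$, with $\mathcal{IC}$ classically consistent, let $\mathcal{UDB}=(\mathcal{D},\mathcal{IC})$, and let $\mathcal{T}$ be the abductive theory encoding the integration of $\mathcal{DB}_1,\dots,\mathcal{DB}_n$. Suppose that the query `$\leftarrow \mathtt{true}$' has a finite SLDNFA refutation tree with respect to $\mathcal{T}$. Let $\leq$ be either $\leq_i$ or $\leq_c$. Then: (1) for every output $(\mathrm{Insert},\mathrm{Retract})$ obtained by running $\mathcal{T}$ in the $\mathcal{A}$-system together with a $\leq$-optimizer, there is a $\leq$-maximally consistent element $N$ in $\mathcal{M}^{\mathcal{UDB}}$ such that $\mathrm{Insert}^N=\mathrm{Insert}$ and $\mathrm{Retract}^N=\mathrm{Retract}$; (2) for every $\leq$-maximally consistent element $N$ in $\mathcal{M}^{\mathcal{UDB}}$ there is a solution $(\mathrm{Insert},\mathrm{Retract})$ obtained by running $\mathcal{T}$ in the $\mathcal{A}$-system together with a $\leq$-optimizer such that $\mathrm{Insert}=\mathrm{Insert}^N$ and $\mathrm{Retract}=\mathrm{Retract}^N$.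
   Context: Setting. Fix a first-order language $L$ over a fixed database schema (relation names) and a fixed domain $U$; every element of $U$ has a unique name, there are no other function symbols, quantifiers range over $U$, and equality is identity on $U$. "Atom" means ground atom $P(t)$, with $P$ a relation name and $t$ a tuple over $U$. A database instance $\mathcal{D}$ is a set of atoms with finite active domain. A database is a pair $(\mathcal{D},\mathcal{IC})$ with $\mathcal{D}$ an instance and $\mathcal{IC}$ (integrity constraints) a finite set of first-order formulas of $L$ (free variables, if any, read as universally quantified). The unified database $\mathcal{UDB}$ need not be consistent. Two-valued semantics. A two-valued valuation assigns $t$ or $f$ to each atom and extends classically to all formulas; a classical (two-valued) model of $\mathcal{IC}$ is such a valuation making all formulas of $\mathcal{IC}$ true. $\mathcal{IC}$ is classically consistent if it has a classical model. For a set $S$ of atoms, $\mathcal{H}^{S}$ (the minimal Herbrand model of $S$) assigns $t$ to the atoms in $S$ and $f$ to all other atoms; $S\models\mathcal{IC}$ means $\mathcal{H}^{S}$ is a model of $\mathcal{IC}$. $(S,\mathcal{IC})$ is consistent if $\mathcal{IC}$ is classically consistent and $S\models\mathcal{IC}$. Repairs. A repair of $(\mathcal{D},\mathcal{IC})$ is a pair $(\mathrm{Insert},\mathrm{Retract})$ of sets of atoms such that (1) $\mathrm{Insert}\cap\mathcal{D}=\emptyset$, (2) $\mathrm{Retract}\subseteq\mathcal{D}$, (3) $((\mathcal{D}\cup\mathrm{Insert})\setminus\mathrm{Retract},\mathcal{IC})$ is consistent. Preferences on repairs: $(I',R')\leq_i(I,R)$ iff $I\subseteq I'$ and $R\subseteq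 R'$; $(I',R')\leq_c(I,R)$ iff $|I|+|R|\leq|I'|+|R'|$. For $\leq$ one of these, a repair $(I,R)$ is $\leq$-preferred if for every repair $(I',R')$, $(I,R)\leq(I',R')$ implies $(I',R')\leq(I,R)$. Three-valued notions. The truth values are $t,f,\top$. The order $\leq_k$ has $f<_k\top$ and $t<_k\top$, with $t,f$ incomparable; $\oplus$ is the join for $\leq_k$ (so $x\oplus x=x$, and $x\oplus y=\top$ if $x\neq y$). A three-valued valuation assigns a value in $\{t,f,\top\}$ to each atom; $\nu\geq_k\mu$ and $\nu\oplus\mu$ are understood pointwise on atoms; $\nu^{x}$ is the set of atoms $p$ with $\nu(p)=x$. Put $\mathrm{Insert}^N=N^{\top}\setminus\mathcal{D}$, $\mathrm{Retract}^N=N^{\top}\cap\mathcal{D}$, and $\mathcal{M}^{\mathcal{UDB}}=\{N \mid N \text{ is a three-valued valuation with } N\geq_k\mathcal{H}^{\mathcal{D}}\oplus M \text{ for some classical model } M \text{ of } \mathcal{IC}\}$. An element $N\in\mathcal{S}$ of a set $\mathcal{S}$ of three-valued valuations is $\leq_i$-maximally consistent in $\mathcal{S}$ if no $N'\in\mathcal{S}$ has $N'^{\top}\subsetneq N^{\top}$, and $\leq_c$-maximally consistent in $\mathcal{S}$ if no $N'\in\mathcal{S}$ has $\#(N'^{\top})<\#(N^{\top})$, where $\#$ denotes cardinality. The abductive theory $\mathcal{T}$. It has defined predicates $\mathtt{db},\mathtt{fact}$ and open (abducible) predicates $\mathtt{insert},\mathtt{retract}$, ranging over atoms of $L$; facts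 $\mathtt{db}(p)$ for each $p\in\mathcal{D}$; rules $\mathtt{fact}(X)\leftarrow \mathtt{db}(X),\ \mathtt{not}\ \mathtt{retract}(X)$ and $\mathtt{fact}(X)\leftarrow\mathtt{insert}(X)$; constraints $\mathtt{false}\leftarrow\mathtt{retract}(X),\ \mathtt{not}\ \mathtt{db}(X)$ and $\mathtt{false}\leftarrow\mathtt{insert}(X),\ \mathtt{db}(X)$; and all formulas of $\mathcal{IC}$ with every database atom $R(x)$ replaced by $\mathtt{fact}(R(x))$. The solver. The $\mathcal{A}$-system is an abductive solver implementing SLDNFA-resolution (a refutation procedure for abductive logic programs). Run on $\mathcal{T}$ with query `$\leftarrow\mathtt{true}$', it outputs abductive solutions, each a pair $(\mathrm{Insert},\mathrm{Retract})$ of finite lists of atoms abduced for $\mathtt{insert}$ and $\mathtt{retract}$. A $\leq$-optimizer is a branch-and-bound component that filters the solutions so as to keep the $\leq$-preferred ones. The hypothesis that the query has a finite SLDNFA refutation tree means that the search tree of this procedure on $\mathcal{T}$ is finite. The solver enters through the following previously established specification, to be taken as given, for $\leq$ either $\leq_i$ or $\leq_c$: (a) every output of the $\mathcal{A}$-system for $\mathcal{T}$ is a repair of $\mathcal{UDB}$, and every output of the $\mathcal{A}$-system with a $\leq$-optimizer is a $\leq$-preferred repair of $\mathcal{UDB}$; (b) if the query `$\leftarrow\mathtt{true}$' has a finite SLDNFA tree with respect to $\mathcal{T}$, then every repair of $\mathcal{UDB}$ is an output of the $\mathcal{A}$-system for $\mathcal{T}$, and every $\leq$-preferred repair of $\mathcal{UDB}$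 is an output of the $\mathcal{A}$-system for $\mathcal{T}$ with a $\leq$-optimizer. *)

theory Defs
  imports "HOL-Library.Equipollence"
begin

section \<open>First-order formulas over a schema and a domain\<close>

text \<open>
  Relation names are the elements of a type \<open>'r\<close>, with arities given by a function
  \<open>ar\<close>; the domain of quantification is the type \<open>'u\<close>.  The terms are variables and the
  names of the elements of \<open>'u\<close>.  Formulas are parametrised by their atomic formulas,
  because the abductive theory below uses the same connectives over other atomic formulas.
\<close>

datatype 'u tm = Var nat | Name 'u

datatype (atomics: 'a, 'u) fm =
    Atm 'a
  | Eq "'u tm" "'u tm"
  | Neg "('a, 'u) fm"
  | Conj "('a, 'u) fm" "('a, 'u) fm"
  | Disj "('a, 'u) fm" "('a, 'u) fm"
  | Imp "('a, 'u) fm" "('a, 'u) fm"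
  | Forall nat "('a, 'u) fm"
  | Exists nat "('a, 'u) fm"

type_synonym ('r, 'u) formula = "('r \<times> 'u tm list, 'u) fm"

type_synonym ('r, 'u) atom = "'r \<times> 'u list"

definition wf_formula :: "('r \<Rightarrow> nat) \<Rightarrow> ('r, 'u) formula \<Rightarrow> bool" where
  "wf_formula ar \<phi> \<longleftrightarrow> (\<forall>(P, ts) \<in> atomics \<phi>. length ts = ar P)"

definition atoms :: "('r \<Rightarrow> nat) \<Rightarrow> ('r, 'u) atom set" where
  "atoms ar = {(P, us). length us = ar P}"

section \<open>Two-valued semantics\<close>

text \<open>
  Valuations are total functions on \<open>'r \<times> 'u list\<close>; only their values on \<open>atoms ar\<close> matter,
  since well-formed formulas do not see the other values.
\<close>

type_synonym ('r, 'u) valuation2 = "('r, 'u) atom \<Rightarrow> bool"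

primrec tm_val :: "(nat \<Rightarrow> 'u) \<Rightarrow> 'u tm \<Rightarrow> 'u" where
  "tm_val e (Var x) = e x"
| "tm_val e (Name u) = u"

primrec sat :: "('r, 'u) valuation2 \<Rightarrow> (nat \<Rightarrow> 'u) \<Rightarrow> ('r, 'u) formula \<Rightarrow> bool" where
  "sat M e (Atm a) \<longleftrightarrow> M (fst a, map (tm_val e) (snd a))"
| "sat M e (Eq s t) \<longleftrightarrow> tm_val e s = tm_val e t"
| "sat M e (Neg \<phi>) \<longleftrightarrow> \<not> sat M e \<phi>"
| "sat M e (Conj \<phi> \<psi>) \<longleftrightarrow> sat M e \<phi> \<and> sat M e \<psi>"
| "sat M e (Disj \<phi> \<psi>) \<longleftrightarrow> sat M e \<phi> \<or> sat M e \<psi>"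
| "sat M e (Imp \<phi> \<psi>) \<longleftrightarrow> (sat M e \<phi> \<longrightarrow> sat M e \<psi>)"
| "sat M e (Forall x \<phi>) \<longleftrightarrow> (\<forall>u. sat M (e(x := u)) \<phi>)"
| "sat M e (Exists x \<phi>) \<longleftrightarrow> (\<exists>u. sat M (e(x := u)) \<phi>)"

definition classical_model :: "('r, 'u) valuation2 \<Rightarrow> ('r, 'u) formula set \<Rightarrow> bool" where
  "classical_model M IC \<longleftrightarrow> (\<forall>\<phi> \<in> IC. \<forall>e. sat M e \<phi>)"

definition classically_consistent :: "('r, 'u) formula set \<Rightarrow> bool" where
  "classically_consistent IC \<longleftrightarrow> (\<exists>M. classical_model M IC)"

definition herbrand :: "('r, 'u) atom set \<Rightarrow> ('r, 'u) valuation2" where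
  "herbrand S = (\<lambda>p. p \<in> S)"

section \<open>Databases\<close>

definition active_domain :: "('r, 'u) atom set \<Rightarrow> 'u set" where
  "active_domain S = (\<Union>(P, us) \<in> S. set us)"

definition db_instance :: "('r \<Rightarrow> nat) \<Rightarrow> ('r, 'u) atom set \<Rightarrow> bool" where
  "db_instance ar D \<longleftrightarrow> D \<subseteq> atoms ar \<and> finite (active_domain D)"

definition database ::
  "('r \<Rightarrow> nat) \<Rightarrow> ('r, 'u) atom set \<Rightarrow> ('r, 'u) formula set \<Rightarrow> bool" where
  "database ar D IC \<longleftrightarrow> db_instance ar D \<and> finite IC \<and> (\<forall>\<phi> \<in> IC. wf_formula ar \<phi>)"

definition consistent :: "('r, 'u) atom set \<Rightarrow> ('r, 'u) formula set \<Rightarrow> bool" where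
  "consistent S IC \<longleftrightarrow> classically_consistent IC \<and> classical_model (herbrand S) IC"

section \<open>Repairs and preferences\<close>

type_synonym ('r, 'u) atom_sets = "('r, 'u) atom set \<times> ('r, 'u) atom set"

definition is_repair ::
  "('r \<Rightarrow> nat) \<Rightarrow> ('r, 'u) atom set \<Rightarrow> ('r, 'u) formula set \<Rightarrow> ('r, 'u) atom_sets \<Rightarrow> bool" where
  "is_repair ar D IC = (\<lambda>(I, R).
     I \<subseteq> atoms ar \<and> I \<inter> D = {} \<and> R \<subseteq> D \<and> consistent ((D \<union> I) - R) IC)"

datatype preference = Inclusion | Cardinality

text \<open>
  Cardinalities are compared through injections, so that infinite sets are treated
  correctly; the disjoint sum \<open>I <+> R\<close> represents \<open>|I| + |R|\<close>.
\<close>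

fun pref_le :: "preference \<Rightarrow> ('r, 'u) atom_sets \<Rightarrow> ('r, 'u) atom_sets \<Rightarrow> bool" where
  "pref_le Inclusion (I', R') (I, R) \<longleftrightarrow> I \<subseteq> I' \<and> R \<subseteq> R'"
| "pref_le Cardinality (I', R') (I, R) \<longleftrightarrow> I <+> R \<lesssim> I' <+> R'"

definition preferred_repair ::
  "('r \<Rightarrow> nat) \<Rightarrow> preference \<Rightarrow> ('r, 'u) atom set \<Rightarrow> ('r, 'u) formula set
    \<Rightarrow> ('r, 'u) atom_sets \<Rightarrow> bool" where
  "preferred_repair ar pr D IC X \<longleftrightarrow> is_repair ar D IC X \<and>
     (\<forall>Y. is_repair ar D IC Y \<longrightarrow> pref_le pr X Y \<longrightarrow> pref_le pr Y X)"

section \<open>Three-valued valuations\<close>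

datatype tv = Tr | Fa | Top

definition le_k :: "tv \<Rightarrow> tv \<Rightarrow> bool" where
  "le_k x y \<longleftrightarrow> x = y \<or> y = Top"

definition join_k :: "tv \<Rightarrow> tv \<Rightarrow> tv" where
  "join_k x y = (if x = y then x else Top)"

definition tv_of_bool :: "bool \<Rightarrow> tv" where
  "tv_of_bool b = (if b then Tr else Fa)"

type_synonym ('r, 'u) valuation3 = "('r, 'u) atom \<Rightarrow> tv"

definition val_set :: "('r \<Rightarrow> nat) \<Rightarrow> ('r, 'u) valuation3 \<Rightarrow> tv \<Rightarrow> ('r, 'u) atom set" where
  "val_set ar N x = {p \<in> atoms ar. N p = x}"

definition Insert_of ::
  "('r \<Rightarrow> nat) \<Rightarrow> ('r, 'u) atom set \<Rightarrow> ('r, 'u) valuation3 \<Rightarrow> ('r, 'u) atom set" where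
  "Insert_of ar D N = val_set ar N Top - D"

definition Retract_of ::
  "('r \<Rightarrow> nat) \<Rightarrow> ('r, 'u) atom set \<Rightarrow> ('r, 'u) valuation3 \<Rightarrow> ('r, 'u) atom set" where
  "Retract_of ar D N = val_set ar N Top \<inter> D"

definition M_UDB ::
  "('r \<Rightarrow> nat) \<Rightarrow> ('r, 'u) atom set \<Rightarrow> ('r, 'u) formula set \<Rightarrow> ('r, 'u) valuation3 set" where
  "M_UDB ar D IC = {N. \<exists>M. classical_model M IC \<and>
     (\<forall>p \<in> atoms ar. le_k (join_k (tv_of_bool (herbrand D p)) (tv_of_bool (M p))) (N p))}"

fun maximally_consistent ::
  "('r \<Rightarrow> nat) \<Rightarrow> preference \<Rightarrow> ('r, 'u) valuation3 set \<Rightarrow> ('r, 'u) valuation3 \<Rightarrow> bool" where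
  "maximally_consistent ar Inclusion \<S> N \<longleftrightarrow>
     N \<in> \<S> \<and> \<not> (\<exists>N' \<in> \<S>. val_set ar N' Top \<subset> val_set ar N Top)"
| "maximally_consistent ar Cardinality \<S> N \<longleftrightarrow>
     N \<in> \<S> \<and> \<not> (\<exists>N' \<in> \<S>. val_set ar N' Top \<prec> val_set ar N Top)"

section \<open>Abductive theories\<close>

text \<open>
  In an abductive theory the atoms of the database language are objects: the arguments of
  the four predicates are either meta-variables ranging over atoms, or atoms \<open>P(ts)\<close> of the
  database language, possibly with variables of that language in \<open>ts\<close>.
\<close>

datatype abd_pred = Db | Fact | Insert | Retract

datatype ('r, 'u) obj_tm = MVar nat | Obj 'r "'u tm list"

type_synonym ('r, 'u) abd_atom = "abd_pred \<times> ('r, 'u) obj_tm"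

datatype ('r, 'u) literal = LTrue | Pos "('r, 'u) abd_atom" | Naf "('r, 'u) abd_atom"

datatype ('r, 'u) clause =
    Rule "('r, 'u) abd_atom" "('r, 'u) literal list"
  | Denial "('r, 'u) literal list"  \<comment> \<open>\<open>false \<leftarrow> body\<close>\<close>

type_synonym ('r, 'u) query = "('r, 'u) literal list"

record ('r, 'u) abd_theory =
  rules :: "('r, 'u) clause set"
  denials :: "('r, 'u) clause set"
  fo_constraints :: "(('r, 'u) abd_atom, 'u) fm set"
  abducibles :: "abd_pred set"

definition integration_theory ::
  "('r, 'u) atom set \<Rightarrow> ('r, 'u) formula set \<Rightarrow> ('r, 'u) abd_theory" where
  "integration_theory D IC =
    \<lparr>rules =
       {Rule (Db, Obj P (map Name us)) [] | P us. (P, us) \<in> D} \<union>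
       {Rule (Fact, MVar 0) [Pos (Db, MVar 0), Naf (Retract, MVar 0)],
        Rule (Fact, MVar 0) [Pos (Insert, MVar 0)]},
     denials =
       {Denial [Pos (Retract, MVar 0), Naf (Db, MVar 0)],
        Denial [Pos (Insert, MVar 0), Pos (Db, MVar 0)]},
     fo_constraints = map_fm (\<lambda>(P, ts). (Fact, Obj P ts)) id ` IC,
     abducibles = {Insert, Retract}\<rparr>"

section \<open>The abductive solver\<close>

text \<open>
  A solver is known only through its search trees and its outputs.  The search tree for a
  theory and a query is given by its root goal and by the successor goals of each goal.
  The outputs are pairs of finite lists of atoms, the ones abduced for \<open>insert\<close>
  and the ones abduced for \<open>retract\<close>; \<open>opt_outputs\<close> are the outputs with an optimizer.
\<close>

record ('r, 'u, 'g) solver =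
  root_goal :: "('r, 'u) abd_theory \<Rightarrow> ('r, 'u) query \<Rightarrow> 'g"
  succs :: "('r, 'u) abd_theory \<Rightarrow> 'g \<Rightarrow> 'g set"
  outputs :: "('r, 'u) abd_theory \<Rightarrow> ('r, 'u) query
    \<Rightarrow> (('r, 'u) atom list \<times> ('r, 'u) atom list) set"
  opt_outputs :: "preference \<Rightarrow> ('r, 'u) abd_theory \<Rightarrow> ('r, 'u) query
    \<Rightarrow> (('r, 'u) atom list \<times> ('r, 'u) atom list) set"

text \<open>
  A node of the search tree is represented by the path leading to it from the root, listed
  with the root last.
\<close>

inductive_set search_tree ::
  "('r, 'u, 'g) solver \<Rightarrow> ('r, 'u) abd_theory \<Rightarrow> ('r, 'u) query \<Rightarrow> 'g list set"
  for \<A> :: "('r, 'u, 'g) solver" and \<T> :: "('r, 'u) abd_theory" and q :: "('r, 'u) query"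
where
  root_node: "[root_goal \<A> \<T> q] \<in> search_tree \<A> \<T> q"
| succ_node: "g # gs \<in> search_tree \<A> \<T> q \<Longrightarrow> g' \<in> succs \<A> \<T> g
    \<Longrightarrow> g' # g # gs \<in> search_tree \<A> \<T> q"

definition finite_search_tree ::
  "('r, 'u, 'g) solver \<Rightarrow> ('r, 'u) abd_theory \<Rightarrow> ('r, 'u) query \<Rightarrow> bool" where
  "finite_search_tree \<A> \<T> q \<longleftrightarrow> finite (search_tree \<A> \<T> q)"

definition sound_for ::
  "('r, 'u, 'g) solver \<Rightarrow> ('r \<Rightarrow> nat) \<Rightarrow> ('r, 'u) atom set \<Rightarrow> ('r, 'u) formula set \<Rightarrow> bool" where
  "sound_for \<A> ar D IC \<longleftrightarrow>
     (\<forall>(Is, Rs) \<in> outputs \<A> (integration_theory D IC) [LTrue].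
        is_repair ar D IC (set Is, set Rs)) \<and>
     (\<forall>pr. \<forall>(Is, Rs) \<in> opt_outputs \<A> pr (integration_theory D IC) [LTrue].
        preferred_repair ar pr D IC (set Is, set Rs))"

definition complete_for ::
  "('r, 'u, 'g) solver \<Rightarrow> ('r \<Rightarrow> nat) \<Rightarrow> ('r, 'u) atom set \<Rightarrow> ('r, 'u) formula set \<Rightarrow> bool" where
  "complete_for \<A> ar D IC \<longleftrightarrow>
     (finite_search_tree \<A> (integration_theory D IC) [LTrue] \<longrightarrow>
       (\<forall>I R. is_repair ar D IC (I, R) \<longrightarrow>
          (\<exists>(Is, Rs) \<in> outputs \<A> (integration_theory D IC) [LTrue].
             set Is = I \<and> set Rs = R)) \<and>
       (\<forall>pr I R. preferred_repair ar pr D IC (I, R) \<longrightarrow>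
          (\<exists>(Is, Rs) \<in> opt_outputs \<A> pr (integration_theory D IC) [LTrue].
             set Is = I \<and> set Rs = R)))"

end

theory Submission
  imports Defs
begin

text \<open>
  A repair flips the membership in \<open>D\<close> of a set \<open>T\<close> of atoms, and \<open>T\<close> is exactly the set of
  atoms on which \<open>D\<close> disagrees with the resulting classical model.  The sets of \<open>\<top>\<close>-atoms of
  the elements of \<open>M_UDB\<close> are the supersets of these disagreement sets, and both notions of
  optimality say that the respective set is minimal.  A family and its upward closure have the
  same minimal elements for inclusion; for cardinality this needs the disagreement sets to be
  finite, since a proper superset of an infinite set can have the same cardinality.  Finiteness
  comes from the solver: every repair is one of its outputs, which are pairs of finite lists.
\<close>

text \<open>Evaluating terms preserves the length of an argument list, so a well-formed atomic
  formula queries only \<open>atoms ar\<close>. The environment is generalised because quantifiers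
  update it.\<close>

lemma sat_cong_atoms:
  assumes "wf_formula ar \<phi>" and "\<And>p. p \<in> atoms ar \<Longrightarrow> M p = M' p"
  shows "sat M e \<phi> \<longleftrightarrow> sat M' e \<phi>"
  using assms(1)
proof (induction \<phi> arbitrary: e)
  case (Atm a)
  then show ?case
    using assms(2) by (auto simp: wf_formula_def atoms_def split: prod.splits)
qed (simp_all add: wf_formula_def ball_Un)

lemma classical_model_cong_atoms:
  assumes "\<forall>\<phi> \<in> IC. wf_formula ar \<phi>" and "\<And>p. p \<in> atoms ar \<Longrightarrow> M p = M' p"
  shows "classical_model M IC \<longleftrightarrow> classical_model M' IC"
  unfolding classical_model_def using sat_cong_atoms[of ar _ M M'] assms by blast

definition disagreement ::
  "('r \<Rightarrow> nat) \<Rightarrow> ('r, 'u) atom set \<Rightarrow> ('r, 'u) valuation2 \<Rightarrow> ('r, 'u) atom set" where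
  "disagreement ar D M = {p \<in> atoms ar. M p \<noteq> herbrand D p}"

text \<open>Flipping \<open>D\<close> on the disagreement set gives back \<open>M\<close> on
  \<open>atoms ar\<close>, and well-formed constraints see no other values of
  \<open>M\<close>.\<close>

lemma is_repair_iff_disagreement:
  assumes "D \<subseteq> atoms ar" and "\<forall>\<phi> \<in> IC. wf_formula ar \<phi>"
  shows "is_repair ar D IC (I, R) \<longleftrightarrow>
    (\<exists>M. classical_model M IC \<and> I = disagreement ar D M - D \<and> R = disagreement ar D M \<inter> D)"
    (is "_ \<longleftrightarrow> ?rhs")
proof
  assume rep: "is_repair ar D IC (I, R)"
  let ?M = "herbrand ((D \<union> I) - R)"
  from rep have "classical_model ?M IC"
    by (simp add: is_repair_def consistent_def)
  moreover have "I = disagreement ar D ?M - D" "R = disagreement ar D ?M \<inter> D"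
    using rep assms(1) by (auto simp: is_repair_def disagreement_def herbrand_def)
  ultimately show ?rhs by blast
next
  assume ?rhs
  then obtain M where M: "classical_model M IC"
    and I: "I = disagreement ar D M - D" and R: "R = disagreement ar D M \<inter> D"
    by blast
  have "M p = herbrand ((D \<union> I) - R) p" if "p \<in> atoms ar" for p
    using that I R by (auto simp: disagreement_def herbrand_def)
  with M have "classical_model (herbrand ((D \<union> I) - R)) IC"
    using classical_model_cong_atoms[of IC ar M] assms(2) by blast
  then show "is_repair ar D IC (I, R)"
    using I R by (auto simp: is_repair_def consistent_def classically_consistent_def
        disagreement_def)
qed

text \<open>The join of two distinct classical values is \<open>Top\<close>, and nothing else lies
  above \<open>Top\<close>.\<close>

lemma disagreement_subset_Top:
  assumes "N \<in> M_UDB ar D IC"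
  obtains M where "classical_model M IC" and "disagreement ar D M \<subseteq> val_set ar N Top"
proof -
  obtain M where "classical_model M IC" and
    "\<forall>p \<in> atoms ar. le_k (join_k (tv_of_bool (herbrand D p)) (tv_of_bool (M p))) (N p)"
    using assms by (auto simp: M_UDB_def)
  then show thesis
    by (intro that[of M])
      (auto simp: disagreement_def val_set_def le_k_def join_k_def tv_of_bool_def split: if_splits)
qed

lemma M_UDB_with_Top_disagreement:
  assumes "classical_model M IC"
  obtains N where "N \<in> M_UDB ar D IC" and "val_set ar N Top = disagreement ar D M"
proof
  \<comment> \<open>The least valuation that \<open>M\<close> allows: the join itself, with no
    additional \<open>Top\<close>.\<close>
  let ?N = "\<lambda>p. join_k (tv_of_bool (herbrand D p)) (tv_of_bool (M p))"
  show "?N \<in> M_UDB ar D IC"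
    using assms by (auto simp: M_UDB_def le_k_def)
  show "val_set ar ?N Top = disagreement ar D M"
    by (auto simp: val_set_def disagreement_def join_k_def tv_of_bool_def)
qed

text \<open>A preorder that lets one argument serve both preferences. Its arguments are in the
  opposite order to \<open>pref_le\<close>, where the better repair stands on the right.\<close>

fun pref_subset :: "preference \<Rightarrow> 'a set \<Rightarrow> 'a set \<Rightarrow> bool" where
  "pref_subset Inclusion A B \<longleftrightarrow> A \<subseteq> B"
| "pref_subset Cardinality A B \<longleftrightarrow> A \<lesssim> B"

lemma pref_subset_trans: "pref_subset pr A B \<Longrightarrow> pref_subset pr B C \<Longrightarrow> pref_subset pr A C"
  by (cases pr) (auto intro: lepoll_trans)

lemma subset_imp_pref_subset: "A \<subseteq> B \<Longrightarrow> pref_subset pr A B"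
  by (cases pr) (auto intro: subset_imp_lepoll)

text \<open>For cardinality, an injection of \<open>B\<close> into the finite set \<open>A\<close>
  makes \<open>B\<close> finite and no larger than its subset \<open>A\<close>.\<close>

lemma finite_pref_subset_imp_eq:
  assumes "finite A" and "A \<subseteq> B" and "pref_subset pr B A"
  shows "A = B"
proof (cases pr)
  case Inclusion
  with assms show ?thesis by simp
next
  case Cardinality
  with assms have "B \<lesssim> A" by simp
  then obtain f where f: "inj_on f B" "f ` B \<subseteq> A"
    unfolding lepoll_def by blast
  with assms(1) have "finite B" and "card B \<le> card A"
    by (auto intro: inj_on_finite card_inj_on_le)
  with assms(2) show ?thesis by (simp add: card_seteq)
qed

lemma Plus_diff_inter_eqpoll: "(A - D) <+> (A \<inter> D) \<approx> A"
proof -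
  \<comment> \<open>Forgetting the tag is injective because the two summands are disjoint.\<close>
  have "bij_betw (case_sum id id) ((A - D) <+> (A \<inter> D)) A"
    by (auto simp: bij_betw_def inj_on_def image_def split: sum.splits)
  then show ?thesis
    unfolding eqpoll_def by blast
qed

lemma pref_le_iff_pref_subset:
  "pref_le pr (A - D, A \<inter> D) (B - D, B \<inter> D) \<longleftrightarrow> pref_subset pr B A"
proof (cases pr)
  case Inclusion
  then show ?thesis by auto
next
  case Cardinality
  then show ?thesis
    using Plus_diff_inter_eqpoll[of A D] Plus_diff_inter_eqpoll[of B D]
    by (simp, meson eqpoll_sym lepoll_trans1 lepoll_trans2)
qed

text \<open>For cardinality, the strict comparison excludes a bijection; by Schroeder-Bernstein this
  amounts to excluding an injection back.\<close>

lemma maximally_consistent_iff: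
  "maximally_consistent ar pr \<S> N \<longleftrightarrow> N \<in> \<S> \<and>
    (\<forall>N' \<in> \<S>. pref_subset pr (val_set ar N' Top) (val_set ar N Top) \<longrightarrow>
      pref_subset pr (val_set ar N Top) (val_set ar N' Top))"
proof (cases pr)
  case Inclusion
  then show ?thesis by auto
next
  case Cardinality
  then show ?thesis
    by (simp add: lesspoll_def, meson lepoll_antisym eqpoll_imp_lepoll eqpoll_sym)
qed

lemma preferred_repair_iff_disagreement:
  assumes "D \<subseteq> atoms ar" and "\<forall>\<phi> \<in> IC. wf_formula ar \<phi>"
  shows "preferred_repair ar pr D IC (A - D, A \<inter> D) \<longleftrightarrow>
    (\<exists>M. classical_model M IC \<and> A = disagreement ar D M) \<and>
    (\<forall>M. classical_model M IC \<longrightarrow> pref_subset pr (disagreement ar D M) A \<longrightarrow>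
      pref_subset pr A (disagreement ar D M))"
proof -
  \<comment> \<open>Splitting along \<open>D\<close> loses no information, so a repair can be
    identified with the single set \<open>A\<close>.\<close>
  have eq: "A - D = B - D \<and> A \<inter> D = B \<inter> D \<longleftrightarrow> A = B" for B
    by blast
  have all: "(\<forall>Y. is_repair ar D IC Y \<longrightarrow> P Y) \<longleftrightarrow>
      (\<forall>M. classical_model M IC \<longrightarrow> P (disagreement ar D M - D, disagreement ar D M \<inter> D))" for P
    unfolding split_paired_All is_repair_iff_disagreement[OF assms] by blast
  then show ?thesis
    unfolding preferred_repair_def all is_repair_iff_disagreement[OF assms]
    by (simp add: pref_le_iff_pref_subset eq)
qed

text \<open>Membership of \<open>N\<close> stays on the right-hand side because
  \<open>Insert_of\<close> and \<open>Retract_of\<close> record only where \<open>N\<close> is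
  \<open>Top\<close>, not its classical values elsewhere.\<close>

lemma maximally_consistent_iff_preferred_repair:
  assumes "D \<subseteq> atoms ar" and "\<forall>\<phi> \<in> IC. wf_formula ar \<phi>"
    and fin: "\<forall>M. classical_model M IC \<longrightarrow> finite (disagreement ar D M)"
  shows "maximally_consistent ar pr (M_UDB ar D IC) N \<longleftrightarrow>
    N \<in> M_UDB ar D IC \<and> preferred_repair ar pr D IC (Insert_of ar D N, Retract_of ar D N)"
proof -
  let ?T = "val_set ar N Top"
  let ?min = "\<lambda>S. pref_subset pr S ?T \<longrightarrow> pref_subset pr ?T S"
  \<comment> \<open>Every disagreement set is the \<open>Top\<close>-set of some member, and every
    \<open>Top\<close>-set contains a disagreement set; transitivity carries the bound from the
    smaller set to the larger.\<close>
  have min_iff: "(\<forall>N' \<in> M_UDB ar D IC. ?min (val_set ar N' Top)) \<longleftrightarrow>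
    (\<forall>M. classical_model M IC \<longrightarrow> ?min (disagreement ar D M))" (is "?minN \<longleftrightarrow> ?minM")
  proof
    assume ?minN
    then show ?minM
      by (metis M_UDB_with_Top_disagreement)
  next
    assume minM: ?minM
    show ?minN
    proof (intro ballI impI)
      fix N'
      assume "N' \<in> M_UDB ar D IC" and le: "pref_subset pr (val_set ar N' Top) ?T"
      then obtain M where M: "classical_model M IC"
        and sub: "pref_subset pr (disagreement ar D M) (val_set ar N' Top)"
        using disagreement_subset_Top subset_imp_pref_subset by metis
      have "pref_subset pr (disagreement ar D M) ?T"
        using sub le by (rule pref_subset_trans)
      with minM M have "pref_subset pr ?T (disagreement ar D M)"
        by blast
      then show "pref_subset pr ?T (val_set ar N' Top)"
        using sub by (rule pref_subset_trans)
    qed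
  qed
  \<comment> \<open>A minimal \<open>Top\<close>-set contains a finite disagreement set that it
    cannot exceed in the preorder, so the two are equal.\<close>
  have "\<exists>M. classical_model M IC \<and> ?T = disagreement ar D M"
    if N: "N \<in> M_UDB ar D IC" and minM: ?minM
  proof -
    from N obtain M where M: "classical_model M IC" and sub: "disagreement ar D M \<subseteq> ?T"
      by (rule disagreement_subset_Top)
    with M minM have "pref_subset pr ?T (disagreement ar D M)"
      by (blast intro: subset_imp_pref_subset)
    with M sub show ?thesis
      using finite_pref_subset_imp_eq fin by metis
  qed
  then show ?thesis
    unfolding maximally_consistent_iff min_iff Insert_of_def Retract_of_def
      preferred_repair_iff_disagreement[OF assms(1,2)]
    by blast
qed

theorem corollary3:
  fixes ar :: "'r \<Rightarrow> nat"
    and n :: nat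
    and Ds :: "nat \<Rightarrow> ('r, 'u) atom set"
    and ICs :: "nat \<Rightarrow> ('r, 'u) formula set"
    and D :: "('r, 'u) atom set"
    and IC :: "('r, 'u) formula set"
    and \<T> :: "('r, 'u) abd_theory"
    and \<A> :: "('r, 'u, 'g) solver"
    and pr :: preference
  assumes "\<And>i. i \<in> {1..n} \<Longrightarrow> database ar (Ds i) (ICs i)"
    and "\<And>i. i \<in> {1..n} \<Longrightarrow> consistent (Ds i) (ICs i)"
    and "D = (\<Union>i \<in> {1..n}. Ds i)"
    and "IC = (\<Union>i \<in> {1..n}. ICs i)"
    and "classically_consistent IC"
    and "\<T> = integration_theory D IC"
    and "sound_for \<A> ar D IC"
    and "complete_for \<A> ar D IC"
    and "finite_search_tree \<A> \<T> [LTrue]"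
  shows "(\<forall>(Is, Rs) \<in> opt_outputs \<A> pr \<T> [LTrue].
            \<exists>N. maximally_consistent ar pr (M_UDB ar D IC) N \<and>
                Insert_of ar D N = set Is \<and> Retract_of ar D N = set Rs) \<and>
         (\<forall>N. maximally_consistent ar pr (M_UDB ar D IC) N \<longrightarrow>
            (\<exists>(Is, Rs) \<in> opt_outputs \<A> pr \<T> [LTrue].
                set Is = Insert_of ar D N \<and> set Rs = Retract_of ar D N))"
proof -
  have D: "D \<subseteq> atoms ar"
    unfolding assms(3) using assms(1) unfolding database_def db_instance_def by blast
  have wf: "\<forall>\<phi> \<in> IC. wf_formula ar \<phi>"
    unfolding assms(4) using assms(1) unfolding database_def by blast
  \<comment> \<open>As \<open>M\<close> is an arbitrary model, its repair may fail to be preferred;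
    hence completeness is applied to the plain \<open>outputs\<close>.\<close>
  have fin: "\<forall>M. classical_model M IC \<longrightarrow> finite (disagreement ar D M)"
  proof (intro allI impI)
    fix M
    assume "classical_model M IC"
    then have "is_repair ar D IC (disagreement ar D M - D, disagreement ar D M \<inter> D)"
      using is_repair_iff_disagreement[OF D wf] by blast
    then obtain Is Rs :: "('r, 'u) atom list"
      where "set Is = disagreement ar D M - D" and "set Rs = disagreement ar D M \<inter> D"
      using assms(6,8,9) unfolding complete_for_def by blast
    then show "finite (disagreement ar D M)"
      by (metis List.finite_set Un_Diff_Int finite_Un)
  qed
  note mc_iff = maximally_consistent_iff_preferred_repair[OF D wf fin]
  have maximal: "\<exists>N. maximally_consistent ar pr (M_UDB ar D IC) N \<and>
      Insert_of ar D N = I \<and> Retract_of ar D N = R"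
    if pref: "preferred_repair ar pr D IC (I, R)" for I R
  proof -
    from pref have "is_repair ar D IC (I, R)"
      by (simp add: preferred_repair_def)
    then obtain M where M: "classical_model M IC"
      and IR: "I = disagreement ar D M - D" "R = disagreement ar D M \<inter> D"
      using is_repair_iff_disagreement[OF D wf] by blast
    \<comment> \<open>The repair fixes only the \<open>Top\<close>-atoms of the witness; its other
      values come from the model \<open>M\<close> behind the repair.\<close>
    obtain N where N: "N \<in> M_UDB ar D IC" and "val_set ar N Top = disagreement ar D M"
      using M by (rule M_UDB_with_Top_disagreement)
    then have "Insert_of ar D N = I" and "Retract_of ar D N = R"
      by (simp_all add: Insert_of_def Retract_of_def IR)
    with N pref show ?thesis
      using mc_iff by blast
  qed
  have sound: "preferred_repair ar pr D IC (set Is, set Rs)"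
    if "(Is, Rs) \<in> opt_outputs \<A> pr \<T> [LTrue]" for Is Rs
    using that assms(6,7) unfolding sound_for_def by blast
  have complete: "\<exists>(Is, Rs) \<in> opt_outputs \<A> pr \<T> [LTrue]. set Is = I \<and> set Rs = R"
    if "preferred_repair ar pr D IC (I, R)" for I R
    using that assms(6,8,9) unfolding complete_for_def by blast
  show ?thesis
    using maximal sound complete by (simp add: mc_iff case_prod_beta)
qed

end
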